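(* Let $A \in M_n(\mathbb{C})$, and put $P_A = AA^{\dagger}$ and $Q_A = A^{\dagger}A$. Each of the following systems of equations in the unknown $X\in M_n(\mathbb{C})$ is consistent and has the unique solution $X = A^{\dagger}A^{d}A^{\dagger}$: (i) $Q_AXP_A = X$ and $AX = A^{d}A^{\dagger}$; (ii) $Q_AXP_A = X$ and $AXA = A^{d}$; (iii) $Q_AXP_A = X$ and $XA = A^{\dagger}A^{d}$; (iv) $XP_A = X$ and $XA = A^{\dagger}A^{d}$; (v) $Q_AX = X$ and $AX = A^{d}A^{\dagger}$.
   Context: $M_n(\mathbb{C})$ is the set of complex $n\times n$ matrices. $A^{\dagger}$ is the Moore-Penrose inverse of $A$. $A^{d}$ is the Drazin inverse of $A$: the unique $X$ with $A^{k+1}X=A^{k}$, $XAX=X$, $AX=XA$, where $k=\mathrm{Ind}(A)$ is the smallest non-negative integer with $\mathrm{rank}(A^{k})=\mathrm{rank}(A^{k+1})$. *)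

theory Defs
  imports "HOL-Analysis.Analysis"
begin

definition conj_transpose :: "complex^'n^'m \<Rightarrow> complex^'m^'n"
  where "conj_transpose A = map_matrix cnj (transpose A)"

(* The library's power operation on vectors and matrices is componentwise,
   so powers with respect to the matrix product are defined separately. *)
primrec matpow :: "complex^'n^'n \<Rightarrow> nat \<Rightarrow> complex^'n^'n"
  where
    "matpow A 0 = mat 1"
  | "matpow A (Suc k) = A ** matpow A k"

(* The four Penrose equations. *)
definition is_moore_penrose :: "complex^'n^'m \<Rightarrow> complex^'m^'n \<Rightarrow> bool"
  where "is_moore_penrose A X \<longleftrightarrow>
    A ** X ** A = A \<and>
    X ** A ** X = X \<and>
    conj_transpose (A ** X) = A ** X \<and>
    conj_transpose (X ** A) = X ** A"

definition moore_penrose :: "complex^'n^'m \<Rightarrow> complex^'m^'n"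
  where "moore_penrose A = (THE X. is_moore_penrose A X)"

definition mat_index :: "complex^'n^'n \<Rightarrow> nat"
  where "mat_index A = (LEAST k. rank (matpow A k) = rank (matpow A (Suc k)))"

definition is_drazin :: "complex^'n^'n \<Rightarrow> complex^'n^'n \<Rightarrow> bool"
  where "is_drazin A X \<longleftrightarrow>
    matpow A (Suc (mat_index A)) ** X = matpow A (mat_index A) \<and>
    X ** A ** X = X \<and>
    A ** X = X ** A"

definition drazin :: "complex^'n^'n \<Rightarrow> complex^'n^'n"
  where "drazin A = (THE X. is_drazin A X)"

end

(* A generalised inverse U = G A* with A U A = A and A U Hermitian comes from any inner inverse G
   of A* A, because A* A C = 0 forces A C = 0; the same for A* gives V with V A Hermitian, and
   V A U is the Moore-Penrose inverse.  At the index k the row spaces of A^k and A^(k+1) agree, so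
   A^k = Z A^(k+1); then A is injective on the range of A^k, so A^k = A^(k+1) Y as well, and
   A^k Y^(k+1) = Z^(k+1) A^k is the Drazin inverse.  Finally A A^+ A^d = A^d = A^d A^+ A, since
   A^d lies in both A M_n and M_n A, and the five systems are solved by substitution. *)

theory Submission
  imports Defs
begin

section \<open>Inner inverses and the Moore-Penrose inverse\<close>

text \<open>A linear map over a field has a linear section \<open>g\<close> on its range; the matrix
  of \<open>g\<close> serves as \<open>G\<close>.\<close>

lemma exists_inner_inverse:
  fixes A :: "'a::field^'n^'m"
  shows "\<exists>G::'a^'m^'n. A ** G ** A = A"
proof -
  obtain g where g: "Vector_Spaces.linear (*s) (*s) g" "\<forall>v\<in>range ((*v) A). A *v g v = v"
    using vec.linear_exists_right_inverse_on[OF matrix_vector_mul_linear_gen vec.subspace_UNIV, of A]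
    by blast
  have "A ** matrix g ** A = A"
    unfolding matrix_eq
    using g by (simp add: matrix_vector_mul_assoc[symmetric] matrix_works)
  then show ?thesis ..
qed

lemma conj_transpose_component [simp]: "conj_transpose A $ i $ j = cnj (A $ j $ i)"
  by (simp add: conj_transpose_def transpose_def map_matrix_def)

lemma conj_transpose_mult: "conj_transpose (A ** B) = conj_transpose B ** conj_transpose A"
  by (simp add: vec_eq_iff matrix_matrix_mult_def mult.commute)

lemma conj_transpose_conj_transpose [simp]: "conj_transpose (conj_transpose A) = A"
  by (simp add: vec_eq_iff)

text \<open>The diagonal entries of the product are the squared norms of the columns of
  \<open>A\<close>.\<close>

lemma conj_transpose_mult_self_eq_0:
  assumes "conj_transpose A ** A = 0"
  shows "A = 0"
proof -
  have "A $ k $ i = 0" for k i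
  proof -
    have "(\<Sum>k\<in>UNIV. cnj (A $ k $ i) * A $ k $ i) = (conj_transpose A ** A) $ i $ i"
      by (simp add: matrix_matrix_mult_def)
    also have "\<dots> = 0"
      by (simp add: assms)
    finally have "complex_of_real (\<Sum>k\<in>UNIV. (norm (A $ k $ i))\<^sup>2) = 0"
      by (simp only: of_real_sum complex_norm_square mult.commute)
    then have "(\<Sum>k\<in>UNIV. (norm (A $ k $ i))\<^sup>2) = 0"
      by (simp only: of_real_eq_0_iff)
    then show ?thesis
      by (simp add: sum_nonneg_eq_0_iff)
  qed
  then show ?thesis
    by (simp add: vec_eq_iff)
qed

lemma matrix_diff_ldistrib: "A ** (B - C) = A ** B - A ** C"
  for A :: "'a::ring_1^'n^'m"
  by (simp add: vec_eq_iff matrix_matrix_mult_def right_diff_distrib sum_subtractf)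

lemma exists_hermitian_inner_inverse:
  fixes A :: "complex^'n^'m"
  shows "\<exists>U::complex^'m^'n. A ** U ** A = A \<and> conj_transpose (A ** U) = A ** U"
proof -
  define H where "H = conj_transpose A"
  have H': "conj_transpose H = A"
    by (simp add: H_def)
  obtain G where G: "(H ** A) ** G ** (H ** A) = H ** A"
    using exists_inner_inverse by blast
  \<comment> \<open>The inner inverse equation for \<open>H ** A\<close> says exactly that
    \<open>H ** A ** C = 0\<close>.\<close>
  define C where "C = G ** H ** A - mat 1"
  have "H ** (A ** C) = 0"
    using G by (simp add: C_def matrix_diff_ldistrib matrix_mul_assoc)
  then have "conj_transpose (A ** C) ** (A ** C) = 0"
    by (simp add: conj_transpose_mult H_def flip: matrix_mul_assoc)
  then have "A ** C = 0"
    by (rule conj_transpose_mult_self_eq_0)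
  then have 1: "A ** G ** H ** A = A"
    by (simp add: C_def matrix_diff_ldistrib matrix_mul_assoc)
  have 2: "H ** A ** conj_transpose G ** H = H"
    using arg_cong[OF 1, of conj_transpose]
    by (simp add: conj_transpose_mult H' matrix_mul_assoc flip: H_def)
  \<comment> \<open>Expanding the last \<open>H\<close> by 2 and contracting by 1 carries
    \<open>A ** G ** H\<close> to its own adjoint.\<close>
  have "A ** G ** H = A ** G ** H ** A ** conj_transpose G ** H"
    using 2 by (metis matrix_mul_assoc)
  also have "\<dots> = A ** conj_transpose G ** H"
    by (simp add: 1)
  finally have "conj_transpose (A ** (G ** H)) = A ** (G ** H)"
    by (simp add: conj_transpose_mult H' matrix_mul_assoc flip: H_def)
  with 1 show ?thesis
    by (metis matrix_mul_assoc)
qed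

lemma is_moore_penrose_exists: "\<exists>X. is_moore_penrose A X"
proof -
  obtain U where U: "A ** U ** A = A" "conj_transpose (A ** U) = A ** U"
    using exists_hermitian_inner_inverse by blast
  obtain W where W: "conj_transpose A ** W ** conj_transpose A = conj_transpose A"
      "conj_transpose (conj_transpose A ** W) = conj_transpose A ** W"
    using exists_hermitian_inner_inverse by blast
  define V where "V = conj_transpose W"
  have V: "A ** V ** A = A" "conj_transpose (V ** A) = V ** A"
    using arg_cong[OF W(1), of conj_transpose] W(2)
    by (simp_all add: V_def conj_transpose_mult matrix_mul_assoc)
  \<comment> \<open>The candidate inherits one Hermitian product from \<open>U\<close> and the other
    from \<open>V\<close>.\<close>
  have "A ** (V ** A ** U) = A ** U" "(V ** A ** U) ** A = V ** A"
    using U(1) V(1) by (metis matrix_mul_assoc)+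
  then have "is_moore_penrose A (V ** A ** U)"
    using U V by (simp add: is_moore_penrose_def) (metis matrix_mul_assoc)
  then show ?thesis ..
qed

text \<open>\<open>A ** X\<close> and \<open>A ** Y\<close> are orthogonal projections onto the same
  range, hence equal; dually \<open>X ** A = Y ** A\<close>. Then
  \<open>X = X ** A ** X = X ** A ** Y = Y ** A ** Y = Y\<close>.\<close>

lemma is_moore_penrose_unique:
  assumes X: "is_moore_penrose A X" and Y: "is_moore_penrose A Y"
  shows "X = Y"
proof -
  note X' = X[unfolded is_moore_penrose_def] and Y' = Y[unfolded is_moore_penrose_def]
  have "A ** X = (A ** Y) ** (A ** X)"
    using Y' by (simp add: matrix_mul_assoc)
  also have "\<dots> = conj_transpose ((A ** X) ** (A ** Y))"
    using X' Y' by (simp add: conj_transpose_mult[of "A ** X"])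
  also have "\<dots> = A ** Y"
    using X' Y' by (simp add: matrix_mul_assoc)
  finally have 1: "A ** X = A ** Y" .
  have "X ** A = (X ** A) ** (Y ** A)"
    using Y' by (metis matrix_mul_assoc)
  also have "\<dots> = conj_transpose ((Y ** A) ** (X ** A))"
    using X' Y' by (simp add: conj_transpose_mult[of "Y ** A"])
  also have "\<dots> = Y ** A"
    using X' Y' by (metis matrix_mul_assoc)
  finally have 2: "X ** A = Y ** A" .
  show ?thesis
    using 1 2 X' Y' by (metis matrix_mul_assoc)
qed

lemma is_moore_penrose_moore_penrose: "is_moore_penrose A (moore_penrose A)"
  unfolding moore_penrose_def
  using is_moore_penrose_exists is_moore_penrose_unique by (metis theI)

section \<open>Rank stabilisation and the Drazin inverse\<close>

lemma matpow_add: "matpow A (m + n) = matpow A m ** matpow A n"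
  by (induction m) (simp_all add: matrix_mul_assoc)

lemma matpow_commute:
  assumes "A ** B = B ** A"
  shows "matpow A k ** B = B ** matpow A k"
proof (induction k)
  case (Suc k)
  then show ?case
    using assms by (metis matpow.simps(2) matrix_mul_assoc)
qed simp

lemma matpow_Suc2: "matpow A (Suc k) = matpow A k ** A"
  by (simp add: matpow_commute)

section \<open>Ranges, rank and factorisation of powers\<close>

lemma range_matrix_mult_subset: "range ((*v) (A ** B)) \<subseteq> range ((*v) A)"
  for A :: "'a::field^'n^'m"
  by (auto simp: matrix_vector_mul_assoc[symmetric])

lemma subspace_range_matrix: "vec.subspace (range ((*v) A))"
  for A :: "'a::field^'n^'m"
  by (rule vec.subspace_image) simp

lemma span_columns_eq_range:
  fixes A :: "'a::field^'n^'m"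
  shows "vec.span (columns A) = range ((*v) A)"
proof (rule antisym)
  have "column i A = A *v axis i 1" for i
    by (simp add: vec_eq_iff column_def matrix_vector_mult_def axis_def if_distrib cong: if_cong)
  then show "vec.span (columns A) \<subseteq> range ((*v) A)"
    by (intro vec.span_minimal subspace_range_matrix) (auto simp: columns_def)
  show "range ((*v) A) \<subseteq> vec.span (columns A)"
    by (auto intro: matrix_vector_mult_in_columnspace_gen)
qed

text \<open>\<open>rank\<close> is the dimension of the row space, so equal ranks are exploited
  through ranges of transposes.\<close>

lemma rank_eq_dim_range_transpose:
  fixes A :: "'a::field^'n^'m"
  shows "rank A = vec.dim (range ((*v) (transpose A)))"
  by (metis span_columns_eq_range row_rank_def_gen columns_transpose vec.dim_span)

text \<open>For an inner inverse \<open>G\<close>, the product \<open>A ** G\<close> fixes the range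
  of \<open>A\<close>, so \<open>Y = G ** B\<close> works.\<close>

lemma matrix_factor_of_range_subset:
  fixes A :: "'a::field^'n^'m" and B :: "'a^'p^'m"
  assumes "range ((*v) B) \<subseteq> range ((*v) A)"
  shows "\<exists>Y. B = A ** Y"
proof -
  obtain G where G: "A ** G ** A = A"
    using exists_inner_inverse by blast
  have "A ** G ** B = B"
    unfolding matrix_eq
  proof
    fix x
    obtain y where "B *v x = A *v y"
      using assms by blast
    then show "(A ** G ** B) *v x = B *v x"
      using G by (metis matrix_vector_mul_assoc)
  qed
  then show ?thesis
    by (metis matrix_mul_assoc)
qed

text \<open>The \<open>LEAST\<close> is attained: past a power of minimal rank the rank can neither
  grow nor drop.\<close>

lemma rank_matpow_mat_index:
  "rank (matpow A (mat_index A)) = rank (matpow A (Suc (mat_index A)))"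
proof -
  obtain k where k: "\<forall>j. rank (matpow A k) \<le> rank (matpow A j)"
    using ex_has_least_nat[of "\<lambda>_. True" 0 "\<lambda>k. rank (matpow A k)"] by blast
  have "rank (matpow A (Suc k)) \<le> rank (matpow A k)"
    unfolding rank_eq_dim_range_transpose matpow.simps matrix_transpose_mul
    by (rule vec.dim_subset[OF range_matrix_mult_subset])
  with k have "rank (matpow A k) = rank (matpow A (Suc k))"
    by (metis le_antisym)
  then show ?thesis
    unfolding mat_index_def by (rule LeastI)
qed

lemma matpow_mat_index_left_factor:
  "\<exists>Z. matpow A (mat_index A) = Z ** matpow A (Suc (mat_index A))"
proof -
  let ?B = "matpow A (mat_index A)"
  have "range ((*v) (transpose (A ** ?B))) = range ((*v) (transpose ?B))"
    using rank_matpow_mat_index[of A] range_matrix_mult_subset[of "transpose ?B" "transpose A"]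
    unfolding rank_eq_dim_range_transpose matpow.simps matrix_transpose_mul
    by (intro vec.subspace_dim_equal subspace_range_matrix) (assumption, rule eq_refl)
  then obtain Y where "transpose ?B = transpose (A ** ?B) ** Y"
    using matrix_factor_of_range_subset by blast
  then show ?thesis
    by (metis matpow.simps(2) matrix_transpose_mul transpose_transpose)
qed

lemma matpow_mat_index_right_factor:
  "\<exists>Y. matpow A (mat_index A) = matpow A (Suc (mat_index A)) ** Y"
proof -
  let ?B = "matpow A (mat_index A)"
  obtain Z where Z: "?B = Z ** (A ** ?B)"
    using matpow_mat_index_left_factor[of A] by auto
  \<comment> \<open>\<open>Z\<close> undoes \<open>A\<close> on the range of \<open>?B\<close>.
    Hence \<open>A\<close> preserves the dimension of that range, which turns row space information
    into column space information.\<close>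
  have inj: "inj_on ((*v) A) (range ((*v) ?B))"
  proof (rule inj_onI)
    fix x y
    assume "x \<in> range ((*v) ?B)" "y \<in> range ((*v) ?B)" "A *v x = A *v y"
    then show "x = y"
      using Z by (metis (no_types, lifting) imageE matrix_vector_mul_assoc)
  qed
  have eq: "range ((*v) (A ** ?B)) = (*v) A ` range ((*v) ?B)"
    by (auto simp: matrix_vector_mul_assoc[symmetric])
  have "vec.dim (range ((*v) (A ** ?B))) = vec.dim (range ((*v) ?B))"
    unfolding eq using inj
    by (intro vec.dim_image_eq) (simp_all add: vec.span_eq_iff[THEN iffD2] subspace_range_matrix)
  moreover have "range ((*v) (A ** ?B)) \<subseteq> range ((*v) ?B)"
    using range_matrix_mult_subset[of ?B A] matpow_commute[of A A] by simp
  ultimately have "range ((*v) (A ** ?B)) = range ((*v) ?B)"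
    by (intro vec.subspace_dim_equal subspace_range_matrix) simp_all
  then show ?thesis
    using matrix_factor_of_range_subset[of ?B "A ** ?B"] by simp
qed

section \<open>Existence and uniqueness of the Drazin inverse\<close>

lemma matpow_right_factor_iterate:
  assumes "matpow A k = matpow A (Suc k) ** Y"
  shows "matpow A k = matpow A (k + m) ** matpow Y m"
proof (induction m)
  case (Suc m)
  have "matpow A (m + k) = matpow A (m + Suc k) ** Y"
    using assms by (metis matpow_add matrix_mul_assoc)
  then show ?case
    using Suc by (simp add: add.commute matrix_mul_assoc)
qed simp

lemma matpow_left_factor_iterate:
  assumes "matpow A k = Z ** matpow A (Suc k)"
  shows "matpow A k = matpow Z m ** matpow A (m + k)"
proof (induction m)
  case (Suc m)
  have "matpow A (k + m) = Z ** matpow A (Suc k + m)"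
    using assms by (metis matpow_add matrix_mul_assoc)
  then show ?case
    using Suc by (simp add: matpow_Suc2 add.commute matrix_mul_assoc del: matpow.simps(2))
       (metis matrix_mul_assoc)
qed simp

lemma is_drazin_exists: "\<exists>X. is_drazin A X"
proof -
  define k where "k = mat_index A"
  obtain Y where Y: "matpow A k = matpow A (Suc k) ** Y"
    using matpow_mat_index_right_factor k_def by blast
  obtain Z where Z: "matpow A k = Z ** matpow A (Suc k)"
    using matpow_mat_index_left_factor k_def by blast
  define B where "B = matpow A k"
  define M where "M = matpow A (Suc k)"
  \<comment> \<open>The exponent \<open>Suc k\<close> yields
    \<open>matpow A (k + Suc k) = M ** B\<close>, so that \<open>M ** X = B\<close> for
    \<open>X = B ** Y'\<close>.\<close>
  define Y' where "Y' = matpow Y (Suc k)"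
  define Z' where "Z' = matpow Z (Suc k)"
  have BM: "A ** B = M" "B ** A = M"
    by (simp_all add: B_def M_def matpow_commute)
  then have BM': "B ** M = M ** B" "A ** M = M ** A"
    by (metis matrix_mul_assoc)+
  note BM = BM BM'
  have BY: "B = M ** B ** Y'" and BZ: "B = Z' ** M ** B"
    using matpow_right_factor_iterate[OF Y, of "Suc k"] matpow_left_factor_iterate[OF Z, of "Suc k"]
    unfolding B_def M_def Y'_def Z'_def
    by (metis matpow_add add.commute matrix_mul_assoc)+
  define X where "X = B ** Y'"
  \<comment> \<open>Both expansions of \<open>B\<close> meet:
    \<open>B ** Y' = Z' ** (M ** B ** Y') = Z' ** B\<close>.\<close>
  have X2: "X = Z' ** B"
    unfolding X_def using BM BY BZ by (metis matrix_mul_assoc)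
  have AX: "A ** X = M ** Y'"
    by (simp add: X_def BM matrix_mul_assoc)
  have XA: "X ** A = Z' ** M"
    by (simp add: X2 BM flip: matrix_mul_assoc)
  have MX: "M ** X = B"
    using BY by (simp add: X_def matrix_mul_assoc)
  have "M ** Y' = Z' ** M ** B ** A ** Y'"
    using BM BZ by (metis matrix_mul_assoc)
  also have "\<dots> = Z' ** A ** (M ** B ** Y')"
    using BM by (metis matrix_mul_assoc)
  also have "\<dots> = Z' ** M"
    using BM BY by (metis matrix_mul_assoc)
  finally have comm: "A ** X = X ** A"
    by (simp add: AX XA)
  have "X ** A ** X = A ** X ** B ** Y'"
    using comm by (simp add: X_def matrix_mul_assoc)
  \<comment> \<open>\<open>X\<close> commutes with \<open>A\<close>, hence with its power
    \<open>B\<close>, so the left side is \<open>M ** X\<close>.\<close>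
  also have "A ** X ** B = B"
    using comm MX BM matpow_commute[OF comm, of k] by (metis B_def matrix_mul_assoc)
  finally have "X ** A ** X = X"
    by (simp add: X_def)
  with MX comm show ?thesis
    unfolding is_drazin_def M_def B_def k_def by blast
qed

text \<open>Commutation turns \<open>X ** A ** X = X\<close> into \<open>X = X ** X ** A\<close>,
  which is then iterated.\<close>

lemma drazin_power_absorb:
  assumes "A ** X = X ** A" "X ** A ** X = X"
  shows "matpow X (Suc k) ** matpow A k = X" "matpow A k ** matpow X (Suc k) = X"
proof -
  have *: "matpow X (Suc k) ** matpow A k = X" for k
  proof (induction k)
    case (Suc k)
    have "matpow X (Suc (Suc k)) ** matpow A (Suc k) = X ** (matpow X (Suc k) ** matpow A k) ** A"
      by (metis matpow.simps(2) matpow_Suc2 matrix_mul_assoc)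
    then show ?case
      using Suc assms by (metis matrix_mul_assoc)
  qed simp
  then show "matpow X (Suc k) ** matpow A k = X" .
  have "matpow A k ** matpow X (Suc k) = matpow X (Suc k) ** matpow A k"
    using matpow_commute assms(1) by metis
  then show "matpow A k ** matpow X (Suc k) = X"
    using * by simp
qed

text \<open>Both inverses equal \<open>X ** A ** Y\<close>: write \<open>X\<close> as
  \<open>matpow X (Suc k) ** matpow A k\<close> and use the index equation of \<open>Y\<close>, then
  symmetrically expand \<open>Y\<close> and use that of \<open>X\<close>.\<close>

lemma is_drazin_unique:
  assumes "is_drazin A X" "is_drazin A Y"
  shows "X = Y"
proof -
  define k where "k = mat_index A"
  have X: "matpow A (Suc k) ** X = matpow A k" "X ** A ** X = X" "A ** X = X ** A"
    and Y: "matpow A (Suc k) ** Y = matpow A k" "Y ** A ** Y = Y" "A ** Y = Y ** A"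
    using assms by (auto simp: is_drazin_def k_def)
  have "X = matpow X (Suc k) ** (matpow A (Suc k) ** Y)"
    using Y(1) drazin_power_absorb(1)[OF X(3,2)] by metis
  also have "\<dots> = (matpow X (Suc k) ** matpow A k) ** A ** Y"
    by (metis matpow_Suc2 matrix_mul_assoc)
  also have "\<dots> = X ** A ** Y"
    using drazin_power_absorb(1)[OF X(3,2)] by simp
  also have "\<dots> = X ** A ** (matpow A k ** matpow Y (Suc k))"
    using drazin_power_absorb(2)[OF Y(3,2)] by simp
  also have "\<dots> = (X ** matpow A (Suc k)) ** matpow Y (Suc k)"
    by (metis matpow.simps(2) matrix_mul_assoc)
  also have "\<dots> = (matpow A (Suc k) ** X) ** matpow Y (Suc k)"
    using matpow_commute[OF X(3)] by metis
  also have "\<dots> = Y"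
    unfolding X(1) by (rule drazin_power_absorb(2)[OF Y(3,2)])
  finally show ?thesis .
qed

lemma is_drazin_drazin: "is_drazin A (drazin A)"
  unfolding drazin_def
  using is_drazin_exists is_drazin_unique by (metis theI)

section \<open>The five systems of equations\<close>

theorem mainTheorem2:
  fixes A P Q :: "complex^'n^'n"
  assumes P_def: "P = A ** moore_penrose A"
    and Q_def: "Q = moore_penrose A ** A"
  shows
    "({X. Q ** X ** P = X \<and> A ** X = drazin A ** moore_penrose A}
        = {moore_penrose A ** drazin A ** moore_penrose A}) \<and>
     ({X. Q ** X ** P = X \<and> A ** X ** A = drazin A}
        = {moore_penrose A ** drazin A ** moore_penrose A}) \<and>
     ({X. Q ** X ** P = X \<and> X ** A = moore_penrose A ** drazin A}
        = {moore_penrose A ** drazin A ** moore_penrose A}) \<and>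
     ({X. X ** P = X \<and> X ** A = moore_penrose A ** drazin A}
        = {moore_penrose A ** drazin A ** moore_penrose A}) \<and>
     ({X. Q ** X = X \<and> A ** X = drazin A ** moore_penrose A}
        = {moore_penrose A ** drazin A ** moore_penrose A})"
proof -
  define M where "M = moore_penrose A"
  define D where "D = drazin A"
  have M: "A ** M ** A = A" "M ** A ** M = M"
    using is_moore_penrose_moore_penrose[of A] by (auto simp: is_moore_penrose_def M_def)
  have D: "D ** A ** D = D" "A ** D = D ** A"
    using is_drazin_drazin[of A] by (auto simp: is_drazin_def D_def)
  \<comment> \<open>Since \<open>D = A ** D ** D = D ** D ** A\<close>, a factor \<open>A\<close>
    stands at either end and absorbs \<open>A ** M\<close> or \<open>M ** A\<close>.\<close>
  have AMD: "A ** M ** D = D" and DMA: "D ** M ** A = D"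
    using M(1) D by (metis matrix_mul_assoc)+
  define X0 where "X0 = M ** D ** M"
  have AX0: "A ** X0 = D ** M" and X0A: "X0 ** A = M ** D"
    using AMD DMA by (metis X0_def matrix_mul_assoc)+
  have QX0: "Q ** X0 = X0" and X0P: "X0 ** P = X0"
    using M(2) by (metis X0_def P_def Q_def M_def matrix_mul_assoc)+
  have AX0A: "A ** X0 ** A = D"
    by (simp add: AX0 DMA)
  \<comment> \<open>In the one-sided systems (iv) and (v) these identities give
    \<open>X = M ** D ** M\<close> at once.\<close>
  have Q: "Q ** X = M ** (A ** X)" and P: "X ** P = (X ** A) ** M" for X
    by (simp_all add: P_def Q_def M_def matrix_mul_assoc)
  have QP: "Q ** X ** P = M ** (A ** X ** A) ** M" for X
    by (simp add: P_def Q_def M_def matrix_mul_assoc)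
  \<comment> \<open>Systems (i) and (iii) reduce to (ii): multiplying their second equation by
    \<open>A\<close> on the missing side gives \<open>A ** X ** A = D\<close>.\<close>
  have QXP_A: "X = X0" if "Q ** X ** P = X" "A ** X ** A = D" for X
    using that by (simp add: QP X0_def)
  have "{X. Q ** X ** P = X \<and> A ** X = D ** M} = {X0}"
    using QXP_A QX0 X0P AX0 DMA by auto
  moreover have "{X. Q ** X ** P = X \<and> A ** X ** A = D} = {X0}"
    using QXP_A QX0 X0P AX0A by auto
  moreover have "{X. Q ** X ** P = X \<and> X ** A = M ** D} = {X0}"
    using QXP_A QX0 X0P X0A AMD by (auto simp flip: matrix_mul_assoc)
  moreover have "{X. X ** P = X \<and> X ** A = M ** D} = {X0}"
    using X0P X0A by (auto simp: P X0_def)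
  moreover have "{X. Q ** X = X \<and> A ** X = D ** M} = {X0}"
    using QX0 AX0 by (auto simp: Q X0_def simp flip: matrix_mul_assoc)
  ultimately show ?thesis
    unfolding M_def D_def X0_def by blast
qed

end
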